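(* Let $\mathbb{K}$ be a field with more than $2$ elements, let $n$ be a non-negative integer, and let $\mathcal{S}$ be a $\mathbb{K}$-linear subspace of $\mathrm{S}_n(\mathbb{K})$ whose codimension in $\mathrm{S}_n(\mathbb{K})$ satisfies $\operatorname{codim} \mathcal{S} \leq n-2$. Then every range-compatible $\mathbb{K}$-linear map $F : \mathcal{S} \to \mathbb{K}^n$ is local.
   Context: $\mathrm{S}_n(\mathbb{K})$ denotes the space of all $n\times n$ symmetric matrices with entries in $\mathbb{K}$; each such matrix is identified with a linear map $\mathbb{K}^n \to \mathbb{K}^n$, $X \mapsto MX$. A map $F : \mathcal{S} \to \mathbb{K}^n$ is range-compatible when $F(M) \in \operatorname{Im} M$ (the column space of $M$) for all $M \in \mathcal{S}$. It is local when there exists $X \in \mathbb{K}^n$ such that $F(M) = MX$ for all $M \in \mathcal{S}$. *)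

theory Defs
  imports "Jordan_Normal_Form.VS_Connect"
begin

definition sym_mats :: "nat \<Rightarrow> 'a :: field mat set" where
  "sym_mats n = {M \<in> carrier_mat n n. M\<^sup>T = M}"

definition sym_space :: "'a :: field itself \<Rightarrow> nat \<Rightarrow> ('a, 'a mat) module" where
  "sym_space ty n = (module_mat ty n n)\<lparr>carrier := sym_mats n\<rparr>"

lemma subspace_sym_mats:
  "subspace class_ring (sym_mats n) (module_mat TYPE('a :: field) n n)"
proof -
  interpret vectorspace class_ring "module_mat TYPE('a) n n" by (rule matrix_vs)
  have add: "(A + B)\<^sup>T = A\<^sup>T + B\<^sup>T"
    if "A \<in> carrier_mat n n" "B \<in> carrier_mat n n" for A B :: "'a mat"
    using that by (intro eq_matI) auto
  have smult: "(c \<cdot>\<^sub>m A)\<^sup>T = c \<cdot>\<^sub>m A\<^sup>T" for c :: 'a and A :: "'a mat"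
    by (intro eq_matI) auto
  have zero: "(0\<^sub>m n n :: 'a mat)\<^sup>T = 0\<^sub>m n n"
    by (intro eq_matI) auto
  show ?thesis
    unfolding subspace_def submodule_def
    using vectorspace_axioms module_axioms
    by (auto simp: sym_mats_def matrix_vs_simps add smult zero)
qed

lemma vectorspace_sym_space: "vectorspace class_ring (sym_space TYPE('a :: field) n)"
  unfolding sym_space_def
  by (rule vectorspace.subspace_is_vs[OF matrix_vs subspace_sym_mats])

(* Meant for finite-dimensional V, where the dimension of the quotient V/W is this difference.
   It is integer-valued so that no truncated subtraction occurs. *)
definition codim :: "('k, 'r) ring_scheme \<Rightarrow> 'v set \<Rightarrow> ('k, 'v, 'm) module_scheme \<Rightarrow> int" where
  "codim K W V = int (vectorspace.dim K V) - int (vectorspace.dim K (V\<lparr>carrier := W\<rparr>))"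

definition range_compatible :: "nat \<Rightarrow> 'a :: field mat set \<Rightarrow> ('a mat \<Rightarrow> 'a vec) \<Rightarrow> bool" where
  "range_compatible n S F \<longleftrightarrow> (\<forall>M\<in>S. F M \<in> vec_space.col_space n M)"

definition local_map :: "nat \<Rightarrow> 'a :: field mat set \<Rightarrow> ('a mat \<Rightarrow> 'a vec) \<Rightarrow> bool" where
  "local_map n S F \<longleftrightarrow> (\<exists>X\<in>carrier_vec n. \<forall>M\<in>S. F M = M *\<^sub>v X)"

end

(* View the orthogonal complement W of S inside the quadratic forms in n variables. Range
   compatibility provides, for every vector v, some g(v) with F(M).v = g(v).Mv on S.
   Call z good when u.Mz = 0 for all M in S only for u = 0, i.e. when z u is in W only for u = 0.
   The codimension bound yields a good y, and then a good z modulo y outside any proper subspace H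
   containing y. Comparing g at y, z and y + c z gives g(y) - g(z) in K (y + c z) for every
   nonzero c; as K has two nonzero elements, g(y) = g(z). Taking for H the set of all v with
   F(M).v = g(y).Mv on S, such a z cannot exist, so H is everything and F(M) = M g(y). *)

theory Submission
  imports Defs "Jordan_Normal_Form.DL_Rank"
begin

text \<open>The field with two elements is a genuine obstacle: there x \<bullet> M x is the scalar
  product of x with the diagonal of M, so the diagonal is orthogonal to ker M. Taking diagonals is
  then linear and range-compatible on all symmetric matrices, but not local for n \<ge> 2. The
  constants come from one count. Symmetric matrices that kill a subspace of codimension r form a
  space of dimension \<open>Suc r choose 2\<close>. Good vectors modulo that subspace exist once the
  codimension inside it is at most r - 1, that is, once the dimension exceeds
  \<open>r choose 2\<close>. The bound n - 2 gives S dimension at least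
  \<open>(n choose 2) + 2\<close>. Requiring M y = 0 costs at most n and leaves
  \<open>(n - 1 choose 2) + 1\<close>, exactly the threshold for r = n - 1. Goodness of z modulo y
  refers to these matrices killing y, and asks only that u lie in K y. Avoiding a prescribed proper
  subspace serves the final contradiction, and it is also what lets the induction for good vectors
  close.\<close>

section \<open>Subspaces of K^n and adjoining a vector\<close>

abbreviation vec_subspace :: "nat \<Rightarrow> 'a :: field vec set \<Rightarrow> bool" where
  "vec_subspace n L \<equiv> subspace class_ring L (module_vec TYPE('a) n)"

lemma vec_subspace_iff:
  "vec_subspace n L \<longleftrightarrow> L \<subseteq> carrier_vec n \<and> 0\<^sub>v n \<in> L \<and>
     (\<forall>v\<in>L. \<forall>w\<in>L. v + w \<in> L) \<and> (\<forall>c. \<forall>v\<in>L. c \<cdot>\<^sub>v v \<in> L)"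
proof -
  interpret vectorspace class_ring "module_vec TYPE('a) n" by (rule vec_vs)
  show ?thesis
    unfolding subspace_def submodule_def using vectorspace_axioms module_axioms
    by (auto simp: module_vec_simps)
qed

definition adjoin :: "'a :: field vec \<Rightarrow> 'a vec set \<Rightarrow> 'a vec set" where
  "adjoin v L = {l + c \<cdot>\<^sub>v v | l c. l \<in> L}"

lemma vec_subspace_adjoin:
  fixes v :: "'a :: field vec"
  assumes "vec_subspace n L" "v \<in> carrier_vec n"
  shows "vec_subspace n (adjoin v L)"
proof -
  have L: "L \<subseteq> carrier_vec n" "0\<^sub>v n \<in> L" "\<And>x y. x \<in> L \<Longrightarrow> y \<in> L \<Longrightarrow> x + y \<in> L"
    "\<And>c x. x \<in> L \<Longrightarrow> c \<cdot>\<^sub>v x \<in> L"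
    using assms(1) by (auto simp: vec_subspace_iff)
  have car: "l \<in> carrier_vec n" if "l \<in> L" for l using L(1) that by auto
  have "0\<^sub>v n = 0\<^sub>v n + 0 \<cdot>\<^sub>v v" using assms(2) by auto
  then have zero: "0\<^sub>v n \<in> adjoin v L" unfolding adjoin_def using L(2) by blast
  have add: "l + c \<cdot>\<^sub>v v + (l' + c' \<cdot>\<^sub>v v) \<in> adjoin v L" if "l \<in> L" "l' \<in> L" for l l' c c'
  proof -
    have "l + c \<cdot>\<^sub>v v + (l' + c' \<cdot>\<^sub>v v) = (l + l') + (c + c') \<cdot>\<^sub>v v"
      using car[OF that(1)] car[OF that(2)] assms(2)
      by (intro eq_vecI) (auto simp: algebra_simps)
    then show ?thesis unfolding adjoin_def using L(3) that by blast
  qed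
  have smult: "d \<cdot>\<^sub>v (l + c \<cdot>\<^sub>v v) \<in> adjoin v L" if "l \<in> L" for l c d
  proof -
    have "d \<cdot>\<^sub>v (l + c \<cdot>\<^sub>v v) = d \<cdot>\<^sub>v l + (d * c) \<cdot>\<^sub>v v"
      using car[OF that] assms(2) by (intro eq_vecI) (auto simp: algebra_simps)
    then show ?thesis unfolding adjoin_def using L(4) that by blast
  qed
  show ?thesis
    unfolding vec_subspace_iff using zero add smult car assms(2)
    by (auto simp: adjoin_def)
qed

lemma subset_adjoin:
  assumes "vec_subspace n L" "v \<in> carrier_vec n"
  shows "L \<subseteq> adjoin v L"
proof
  fix l assume l: "l \<in> L"
  then have "l \<in> carrier_vec n" using assms(1) by (auto simp: vec_subspace_iff)
  then have "l = l + 0 \<cdot>\<^sub>v v" using assms(2) by auto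
  then show "l \<in> adjoin v L" unfolding adjoin_def using l by blast
qed

lemma adjoin_subset:
  assumes "vec_subspace n H" "L \<subseteq> H" "v \<in> H"
  shows "adjoin v L \<subseteq> H"
  using assms by (auto simp: adjoin_def vec_subspace_iff subset_iff)

lemma adjoin_commute:
  assumes "L \<subseteq> carrier_vec n" "v \<in> carrier_vec n" "w \<in> carrier_vec n"
  shows "adjoin v (adjoin w L) = adjoin w (adjoin v L)"
proof -
  have "l + c \<cdot>\<^sub>v w + d \<cdot>\<^sub>v v = l + d \<cdot>\<^sub>v v + c \<cdot>\<^sub>v w" if "l \<in> L" for l c d
    using assms that by (intro eq_vecI) (auto simp: algebra_simps)
  then show ?thesis unfolding adjoin_def by (auto; metis)
qed

text \<open>Steinitz exchange: as \<open>w\<close> is outside \<open>L\<close>, its coefficient of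
  \<open>v\<close> is nonzero, so the relation can be solved for \<open>v\<close>.\<close>

lemma adjoin_exchange:
  assumes L: "vec_subspace n L" and v: "v \<in> carrier_vec n" and w: "w \<in> adjoin v L" "w \<notin> L"
  shows "adjoin w L = adjoin v L"
proof (rule antisym)
  have sub: "vec_subspace n (adjoin v L)" by (rule vec_subspace_adjoin[OF L v])
  show "adjoin w L \<subseteq> adjoin v L"
    by (rule adjoin_subset[OF sub subset_adjoin[OF L v] w(1)])
  obtain l c where lc: "w = l + c \<cdot>\<^sub>v v" "l \<in> L" using w(1) by (auto simp: adjoin_def)
  have lcar: "l \<in> carrier_vec n" using lc(2) L by (auto simp: vec_subspace_iff)
  have wcar: "w \<in> carrier_vec n" using lc lcar v by auto
  have "l + 0 \<cdot>\<^sub>v v = l" using lcar v by (intro eq_vecI) auto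
  then have "c \<noteq> 0" using lc w(2) by auto
  then have "v = (- inverse c) \<cdot>\<^sub>v l + inverse c \<cdot>\<^sub>v w"
    using lc lcar v by (intro eq_vecI) (auto simp: algebra_simps)
  then have "v \<in> adjoin w L" unfolding adjoin_def using lc(2) L
    by (auto simp: vec_subspace_iff)
  then show "adjoin v L \<subseteq> adjoin w L"
    by (intro adjoin_subset[OF vec_subspace_adjoin[OF L wcar] subset_adjoin[OF L wcar]])
qed

section \<open>Codimension in K^n\<close>

(* L has codimension at most r in K^n: adjoining r vectors to L gives everything. *)
primrec codim_le :: "nat \<Rightarrow> nat \<Rightarrow> 'a :: field vec set \<Rightarrow> bool" where
  "codim_le n 0 L \<longleftrightarrow> carrier_vec n \<subseteq> L"
| "codim_le n (Suc r) L \<longleftrightarrow> (\<exists>v\<in>carrier_vec n. codim_le n r (adjoin v L))"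

text \<open>\<open>codim_le\<close> only promises some suitable vector, but any vector outside
  \<open>L\<close> does as well. If \<open>x\<close> lies in \<open>adjoin v L\<close>, it is
  exchanged for \<open>v\<close>; otherwise the induction hypothesis for \<open>adjoin v L\<close>
  applies and the two adjunctions commute.\<close>

lemma codim_le_adjoin:
  assumes "codim_le n (Suc r) L" "vec_subspace n L" "x \<in> carrier_vec n" "x \<notin> L"
  shows "codim_le n r (adjoin x L)"
  using assms
proof (induction r arbitrary: L)
  case 0
  then obtain v where v: "v \<in> carrier_vec n" "carrier_vec n \<subseteq> adjoin v L" by auto
  then have "adjoin x L = adjoin v L" using 0 by (intro adjoin_exchange) auto
  then show ?case using v by simp
next
  case (Suc r)
  then obtain v where v: "v \<in> carrier_vec n" "codim_le n (Suc r) (adjoin v L)" by auto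
  show ?case
  proof (cases "x \<in> adjoin v L")
    case True
    then show ?thesis using adjoin_exchange[OF Suc.prems(2) v(1) True] Suc.prems(4) v(2) by simp
  next
    case False
    have "codim_le n r (adjoin x (adjoin v L))"
      by (rule Suc.IH[OF v(2) vec_subspace_adjoin[OF Suc.prems(2) v(1)] Suc.prems(3) False])
    moreover have "L \<subseteq> carrier_vec n" using Suc.prems(2) by (auto simp: vec_subspace_iff)
    ultimately have "codim_le n r (adjoin v (adjoin x L))"
      using adjoin_commute[of L n v x] v(1) Suc.prems(3) by simp
    then show ?thesis using v(1) by auto
  qed
qed

text \<open>The chain of coordinate subspaces carries the induction; its member r = n is the zero
  space. Adjoining \<open>unit_vec n r\<close> frees exactly coordinate \<open>r\<close>.\<close>

lemma codim_le_first_coords_zero: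
  assumes "r \<le> n"
  shows "codim_le n r {v \<in> carrier_vec n. \<forall>i<r. v $ i = 0}"
  using assms
proof (induction r)
  case (Suc r)
  let ?L = "\<lambda>r. {v \<in> carrier_vec n. \<forall>i<r. v $ i = (0 :: 'a)}"
  let ?e = "unit_vec n r :: 'a vec"
  have "v \<in> adjoin ?e (?L (Suc r))" if "v \<in> ?L r" for v
  proof -
    have "v = (v - v $ r \<cdot>\<^sub>v ?e) + v $ r \<cdot>\<^sub>v ?e" using that by auto
    moreover have "v - v $ r \<cdot>\<^sub>v ?e \<in> ?L (Suc r)" using that Suc.prems
      by (auto simp: less_Suc_eq)
    ultimately show ?thesis unfolding adjoin_def by blast
  qed
  moreover have "v \<in> ?L r" if "v \<in> adjoin ?e (?L (Suc r))" for v
    using that Suc.prems by (auto simp: adjoin_def)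
  ultimately have "adjoin ?e (?L (Suc r)) = ?L r" by blast
  then show ?case using Suc by (auto intro!: bexI[of _ ?e])
qed auto

lemma vec_subspace_zero: "vec_subspace n {0\<^sub>v n}"
  by (auto simp: vec_subspace_iff)

lemma codim_le_zero: "codim_le n n {0\<^sub>v n :: 'a :: field vec}"
proof -
  have "{v \<in> carrier_vec n. \<forall>i<n. v $ i = 0} = {0\<^sub>v n :: 'a vec}"
    by (auto intro!: eq_vecI)
  then show ?thesis using codim_le_first_coords_zero[of n n, where 'a='a] by simp
qed

text \<open>The dual reading of codimension: the orthogonal complement of \<open>L\<close> has
  dimension at most \<open>r\<close>, so \<open>r\<close> linear forms suffice to detect its nonzero
  vectors. The adjoined vectors serve as these forms.\<close>

lemma codim_le_functionals:
  fixes L :: "'a :: field vec set"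
  assumes "codim_le n r L" "L \<subseteq> carrier_vec n"
  obtains vs where "length vs = r" "set vs \<subseteq> carrier_vec n"
    "\<And>w. w \<in> carrier_vec n \<Longrightarrow> (\<And>l. l \<in> L \<Longrightarrow> l \<bullet> w = 0) \<Longrightarrow> (\<And>v. v \<in> set vs \<Longrightarrow> v \<bullet> w = 0) \<Longrightarrow> w = 0\<^sub>v n"
  using assms
proof (induction r arbitrary: L thesis)
  case 0
  have "w = 0\<^sub>v n" if w: "w \<in> carrier_vec n" "\<And>l. l \<in> L \<Longrightarrow> l \<bullet> w = 0" for w
  proof (rule eq_vecI)
    fix i assume "i < dim_vec (0\<^sub>v n :: 'a vec)"
    then have i: "i < n" by simp
    then have "unit_vec n i \<in> L" using 0 by auto
    then show "w $ i = 0\<^sub>v n $ i" using w i by (metis index_zero_vec(1) scalar_prod_left_unit)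
  qed (use w in auto)
  then show ?case using 0(1)[of "[]"] by auto
next
  case (Suc r)
  then obtain v where v: "v \<in> carrier_vec n" "codim_le n r (adjoin v L)" by auto
  have sub: "adjoin v L \<subseteq> carrier_vec n" using Suc.prems(3) v(1) by (auto simp: adjoin_def)
  obtain vs where vs: "length vs = r" "set vs \<subseteq> carrier_vec n"
    "\<And>w. w \<in> carrier_vec n \<Longrightarrow> (\<And>l. l \<in> adjoin v L \<Longrightarrow> l \<bullet> w = 0) \<Longrightarrow> (\<And>v. v \<in> set vs \<Longrightarrow> v \<bullet> w = 0) \<Longrightarrow> w = 0\<^sub>v n"
    using Suc.IH[OF _ v(2) sub] by metis
  show ?case
  proof (rule Suc.prems(1)[of "v # vs"])
    fix w assume w: "w \<in> carrier_vec n" "\<And>l. l \<in> L \<Longrightarrow> l \<bullet> w = 0"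
      "\<And>x. x \<in> set (v # vs) \<Longrightarrow> x \<bullet> w = 0"
    have "l \<bullet> w = 0" if l: "l \<in> adjoin v L" for l
    proof -
      obtain m c where "l = m + c \<cdot>\<^sub>v v" "m \<in> L" using l by (auto simp: adjoin_def)
      moreover from this have "m \<in> carrier_vec n" using Suc.prems(3) by auto
      ultimately show ?thesis
        using w v(1) by (simp add: add_scalar_prod_distrib[of _ n])
    qed
    then show "w = 0\<^sub>v n" using w by (intro vs(3)) auto
  qed (use vs v in auto)
qed

section \<open>Symmetric matrices and dimension counts by linear forms\<close>

lemma sym_mats_scalar_prod:
  fixes M :: "'a :: field mat"
  assumes "M \<in> sym_mats n" "u \<in> carrier_vec n" "v \<in> carrier_vec n"
  shows "u \<bullet> (M *\<^sub>v v) = v \<bullet> (M *\<^sub>v u)"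
proof -
  have M: "M \<in> carrier_mat n n" "M\<^sup>T = M" using assms(1) by (auto simp: sym_mats_def)
  have "u \<bullet> (M *\<^sub>v v) = (M\<^sup>T *\<^sub>v u) \<bullet> v"
    using transpose_vec_mult_scalar[OF M(1) assms(3,2)] by simp
  also have "\<dots> = v \<bullet> (M *\<^sub>v u)" using M assms by (simp add: comm_scalar_prod[of _ n])
  finally show ?thesis .
qed

lemma smult_mat_mult_vec:
  fixes A :: "'a :: comm_ring_1 mat"
  assumes "A \<in> carrier_mat nr nc" "v \<in> carrier_vec nc"
  shows "(c \<cdot>\<^sub>m A) *\<^sub>v v = c \<cdot>\<^sub>v (A *\<^sub>v v)"
  using assms by (intro eq_vecI) auto

(* For a subspace S of matrices this says dim S >= k. In this form passing to a kernel costs one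
   dimension per linear form by definition, so no basis of S has to be handled. *)
definition dim_ge :: "nat \<Rightarrow> 'a :: field mat set \<Rightarrow> nat \<Rightarrow> bool" where
  "dim_ge n S k \<longleftrightarrow> (\<forall>ps. set ps \<subseteq> carrier_vec n \<times> carrier_vec n \<longrightarrow> length ps < k \<longrightarrow>
     (\<exists>M\<in>S. M \<noteq> 0\<^sub>m n n \<and> (\<forall>(v, w)\<in>set ps. v \<bullet> (M *\<^sub>v w) = 0)))"

lemma dim_ge_nonzero:
  assumes "dim_ge n S k" "k > 0"
  obtains M where "M \<in> S" "M \<noteq> 0\<^sub>m n n"
  using assms unfolding dim_ge_def by (metis empty_set empty_subsetI list.size(3))

lemma dim_ge_mono: "dim_ge n S k \<Longrightarrow> j \<le> k \<Longrightarrow> dim_ge n S j"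
  by (auto simp: dim_ge_def)

text \<open>The imposed conditions are themselves forms of the kind that \<open>dim_ge\<close>
  quantifies over, so they are simply appended to the list.\<close>

lemma dim_ge_kernel:
  assumes "dim_ge n S (k + length vs)" "set vs \<subseteq> carrier_vec n" "x \<in> carrier_vec n"
  shows "dim_ge n {M \<in> S. \<forall>v\<in>set vs. v \<bullet> (M *\<^sub>v x) = 0} k"
  unfolding dim_ge_def
proof (intro allI impI)
  fix ps :: "('a vec \<times> 'a vec) list"
  assume "set ps \<subseteq> carrier_vec n \<times> carrier_vec n" "length ps < k"
  then show "\<exists>M\<in>{M \<in> S. \<forall>v\<in>set vs. v \<bullet> (M *\<^sub>v x) = 0}. M \<noteq> 0\<^sub>m n n \<and>
      (\<forall>(v, w)\<in>set ps. v \<bullet> (M *\<^sub>v w) = 0)"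
    using assms(1)[unfolded dim_ge_def, rule_format, of "ps @ map (\<lambda>v. (v, x)) vs"] assms(2,3)
    by (fastforce simp: image_subset_iff)
qed

text \<open>All vectors \<open>M *\<^sub>v x\<close> lie in the orthogonal complement of
  \<open>L\<close>, so making them vanish costs \<open>r\<close> forms instead of
  \<open>n\<close>.\<close>

lemma dim_ge_annihilator:
  fixes x :: "'a :: field vec"
  assumes S: "S \<subseteq> sym_mats n" and D: "dim_ge n S (k + r)"
    and L: "L \<subseteq> carrier_vec n" "codim_le n r L" and x: "x \<in> carrier_vec n"
    and perp: "\<And>M l. M \<in> S \<Longrightarrow> l \<in> L \<Longrightarrow> l \<bullet> (M *\<^sub>v x) = 0"
  shows "dim_ge n {M \<in> S. M *\<^sub>v x = 0\<^sub>v n} k"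
proof -
  obtain vs where vs: "length vs = r" "set vs \<subseteq> carrier_vec n"
    "\<And>w. w \<in> carrier_vec n \<Longrightarrow> (\<And>l. l \<in> L \<Longrightarrow> l \<bullet> w = 0) \<Longrightarrow> (\<And>v. v \<in> set vs \<Longrightarrow> v \<bullet> w = 0) \<Longrightarrow> w = 0\<^sub>v n"
    using codim_le_functionals[OF L(2,1)] by metis
  have "M *\<^sub>v x = 0\<^sub>v n \<longleftrightarrow> (\<forall>v\<in>set vs. v \<bullet> (M *\<^sub>v x) = 0)" if "M \<in> S" for M
  proof -
    have "M *\<^sub>v x \<in> carrier_vec n" using S that x by (auto simp: sym_mats_def)
    then show ?thesis using vs(2,3) perp[OF that] by fastforce
  qed
  then have "{M \<in> S. M *\<^sub>v x = 0\<^sub>v n} = {M \<in> S. \<forall>v\<in>set vs. v \<bullet> (M *\<^sub>v x) = 0}" by blast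
  then show ?thesis using dim_ge_kernel[of n S k vs x] D vs x by simp
qed

lemma perp_of_kills:
  assumes "M \<in> sym_mats n" "l \<in> carrier_vec n" "M *\<^sub>v l = 0\<^sub>v n" "x \<in> carrier_vec n"
  shows "l \<bullet> (M *\<^sub>v x) = 0"
  using assms sym_mats_scalar_prod[of M n l x] by simp

lemma kills_adjoin:
  fixes M :: "'a :: field mat"
  assumes "M \<in> sym_mats n" "L \<subseteq> carrier_vec n" "x \<in> carrier_vec n"
    "\<And>l. l \<in> L \<Longrightarrow> M *\<^sub>v l = 0\<^sub>v n" "M *\<^sub>v x = 0\<^sub>v n" "l \<in> adjoin x L"
  shows "M *\<^sub>v l = 0\<^sub>v n"
proof -
  obtain m c where m: "l = m + c \<cdot>\<^sub>v x" "m \<in> L" using assms(6) by (auto simp: adjoin_def)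
  have "M \<in> carrier_mat n n" using assms(1) by (auto simp: sym_mats_def)
  then show ?thesis using m assms(2-5)
    by (auto simp: mult_add_distrib_mat_vec[of _ n n] mult_mat_vec[of _ n n] subset_iff)
qed

lemma kills_all_imp_zero:
  fixes M :: "'a :: field mat"
  assumes "M \<in> carrier_mat n n" "\<And>x. x \<in> carrier_vec n \<Longrightarrow> M *\<^sub>v x = 0\<^sub>v n"
  shows "M = 0\<^sub>m n n"
proof (rule eq_matI)
  fix i j assume "i < dim_row (0\<^sub>m n n :: 'a mat)" "j < dim_col (0\<^sub>m n n :: 'a mat)"
  then have ij: "i < n" "j < n" by auto
  have "M $$ (i, j) = (M *\<^sub>v unit_vec n j) $ i"
    using assms(1) ij by (simp add: mult_mat_vec_def)
  then show "M $$ (i, j) = 0\<^sub>m n n $$ (i, j)" using assms(2)[of "unit_vec n j"] ij by simp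
qed (use assms in auto)

text \<open>Such matrices are symmetric forms on the quotient by \<open>L\<close>, of dimension at
  most \<open>r\<close>. The induction kills one more vector \<open>v\<close>: by symmetry
  \<open>M *\<^sub>v v\<close> is orthogonal to \<open>L\<close>, so this costs
  \<open>Suc r\<close>, the step between consecutive triangular numbers.\<close>

lemma not_dim_ge_if_kills:
  fixes L :: "'a :: field vec set"
  assumes "S \<subseteq> sym_mats n" "vec_subspace n L" "codim_le n r L"
    "\<And>M l. M \<in> S \<Longrightarrow> l \<in> L \<Longrightarrow> M *\<^sub>v l = 0\<^sub>v n"
  shows "\<not> dim_ge n S (Suc (Suc r choose 2))"
  using assms
proof (induction r arbitrary: S L)
  case 0
  have "M = 0\<^sub>m n n" if "M \<in> S" for M
    using that 0 by (intro kills_all_imp_zero) (auto simp: sym_mats_def)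
  then show ?case by (metis dim_ge_nonzero zero_less_Suc)
next
  case (Suc r)
  then obtain v where v: "v \<in> carrier_vec n" "codim_le n r (adjoin v L)" by auto
  have L: "L \<subseteq> carrier_vec n" using Suc.prems(2) by (auto simp: vec_subspace_iff)
  let ?S = "{M \<in> S. M *\<^sub>v v = 0\<^sub>v n}"
  have "\<not> dim_ge n ?S (Suc (Suc r choose 2))"
    using Suc.prems(1,4) L v
    by (intro Suc.IH[OF _ vec_subspace_adjoin[OF Suc.prems(2) v(1)] v(2)])
      (auto intro: kills_adjoin[of _ n L v])
  moreover have "dim_ge n ?S (Suc (Suc r choose 2))"
    if "dim_ge n S (Suc (Suc (Suc r) choose 2))"
  proof (rule dim_ge_annihilator[OF Suc.prems(1) _ L Suc.prems(3) v(1)])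
    show "dim_ge n S (Suc (Suc r choose 2) + Suc r)"
      using that by (simp add: numeral_2_eq_2 add.commute)
    show "l \<bullet> (M *\<^sub>v v) = 0" if "M \<in> S" "l \<in> L" for M l
      using that Suc.prems(1,4) L v(1) by (intro perp_of_kills[of M n]) auto
  qed
  ultimately show ?case by blast
qed

section \<open>Existence of good vectors\<close>

text \<open>The difference of two points of the line in \<open>H\<close> is a nonzero multiple of
  \<open>x\<close>. A parameter \<open>a\<close> is supplied even when the line misses
  \<open>H\<close>, which saves a case distinction later.\<close>

lemma vec_subspace_line:
  fixes H :: "'a :: field vec set"
  assumes H: "vec_subspace n H" and x: "x \<in> carrier_vec n" "x \<notin> H" and z: "z \<in> carrier_vec n"
  shows "\<exists>a. \<forall>t. z + t \<cdot>\<^sub>v x \<in> H \<longrightarrow> t = a"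
proof -
  have "s = t" if s: "z + s \<cdot>\<^sub>v x \<in> H" and t: "z + t \<cdot>\<^sub>v x \<in> H" for s t
  proof (rule ccontr)
    assume "s \<noteq> t"
    then have "x = inverse (s - t) \<cdot>\<^sub>v ((z + s \<cdot>\<^sub>v x) + (-1) \<cdot>\<^sub>v (z + t \<cdot>\<^sub>v x))"
      using x z by (intro eq_vecI) (auto simp: field_simps)
    moreover have "\<dots> \<in> H" using H s t unfolding vec_subspace_iff by blast
    ultimately show False using x by simp
  qed
  then show ?thesis by blast
qed

text \<open>All that is extracted from the size of the field. The infinite case is listed separately
  because \<open>card\<close> is 0 on infinite sets; \<open>a\<close> and \<open>b\<close> may
  coincide.\<close>

lemma exists_third_element:
  fixes a b :: 'a
  assumes "infinite (UNIV :: 'a set) \<or> card (UNIV :: 'a set) > 2"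
  obtains t where "t \<noteq> a" "t \<noteq> b"
proof -
  have "\<not> UNIV \<subseteq> {a, b}"
  proof
    assume sub: "UNIV \<subseteq> {a, b}"
    then have "finite (UNIV :: 'a set)" using finite_subset by blast
    moreover have "card (UNIV :: 'a set) \<le> card {a, b}" by (intro card_mono sub) auto
    moreover have "card {a, b} \<le> 2" by (simp add: card_insert_if)
    ultimately show False using assms by auto
  qed
  then show ?thesis using that by blast
qed

lemma perp_subspace:
  fixes S :: "'a :: field mat set"
  assumes "S \<subseteq> sym_mats n" "x \<in> carrier_vec n"
  shows "vec_subspace n {u \<in> carrier_vec n. \<forall>M\<in>S. u \<bullet> (M *\<^sub>v x) = 0}"
proof -
  have "M *\<^sub>v x \<in> carrier_vec n" if "M \<in> S" for M
    using that assms by (auto simp: sym_mats_def)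
  then show ?thesis
    by (auto simp: vec_subspace_iff add_scalar_prod_distrib[of _ n] smult_scalar_prod_distrib[of _ n])
qed

(* If all x outside H are bad, pick one, with witness u: then M -> M x has rank below r on S, and
   the induction hypothesis applies to its kernel, with x adjoined to L. It gives z avoiding
   the set U orthogonal to all M x if x is in U. A line z + t x meets H at most once, and U
   at most once, and is good off these points, so three scalars t suffice. *)
lemma exists_good_vector:
  fixes L :: "'a :: field vec set"
  assumes K: "infinite (UNIV :: 'a set) \<or> card (UNIV :: 'a set) > 2"
    and "S \<subseteq> sym_mats n" "vec_subspace n L" "codim_le n r L"
    "\<And>M l. M \<in> S \<Longrightarrow> l \<in> L \<Longrightarrow> M *\<^sub>v l = 0\<^sub>v n"
    "dim_ge n S (Suc (r choose 2))"
    "vec_subspace n H" "L \<subseteq> H" "H \<noteq> carrier_vec n"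
  shows "\<exists>z\<in>carrier_vec n - H. \<forall>u\<in>carrier_vec n. (\<forall>M\<in>S. u \<bullet> (M *\<^sub>v z) = 0) \<longrightarrow> u \<in> L"
  using assms(2-)
proof (induction r arbitrary: S L H)
  case 0
  then show ?case by (auto simp: vec_subspace_iff)
next
  case (Suc r)
  note S = Suc.prems(1) and Lsub = Suc.prems(2) and kills = Suc.prems(4) and H = Suc.prems(6)
  have L: "L \<subseteq> carrier_vec n" using Lsub by (auto simp: vec_subspace_iff)
  show ?case
  proof (rule ccontr)
    assume no_good: "\<not> ?case"
    obtain x where x: "x \<in> carrier_vec n" "x \<notin> H"
      using H Suc.prems(8) by (auto simp: vec_subspace_iff)
    then have xL: "x \<notin> L" using Suc.prems(7) by auto
    obtain u where u: "u \<in> carrier_vec n" "u \<notin> L" "\<And>M. M \<in> S \<Longrightarrow> u \<bullet> (M *\<^sub>v x) = 0"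
      using no_good x by (metis DiffI)
    have perp: "l \<bullet> (M *\<^sub>v w) = 0" if "M \<in> S" "l \<in> L" "w \<in> carrier_vec n" for M l w
      using that S kills L by (intro perp_of_kills[of M n]) auto
    let ?S = "{M \<in> S. M *\<^sub>v x = 0\<^sub>v n}"
    let ?L = "adjoin x L"
    let ?U = "{w \<in> carrier_vec n. \<forall>M\<in>S. w \<bullet> (M *\<^sub>v x) = 0}"
    have U: "vec_subspace n ?U" by (rule perp_subspace[OF S x(1)])
    have LU: "L \<subseteq> ?U" using perp x L by auto
    have L': "vec_subspace n ?L" "codim_le n r ?L"
      using vec_subspace_adjoin[OF Lsub x(1)] codim_le_adjoin[OF Suc.prems(3) Lsub x(1) xL] by auto
    have kills': "M *\<^sub>v l = 0\<^sub>v n" if "M \<in> ?S" "l \<in> ?L" for M l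
      using that S L x(1) kills by (auto intro: kills_adjoin[of M n L x])
    \<comment> \<open>\<open>M *\<^sub>v x\<close> is orthogonal to \<open>u\<close> as well as to
      \<open>L\<close>, so passing to \<open>?S\<close> costs \<open>r\<close> rather than
      \<open>Suc r\<close>. As \<open>Suc r choose 2\<close> is \<open>(r choose 2) + r\<close>, the
      threshold for \<open>r\<close> is met exactly.\<close>
    have D': "dim_ge n ?S (Suc (r choose 2))"
    proof (rule dim_ge_annihilator[OF S])
      show "dim_ge n S (Suc (r choose 2) + r)"
        using Suc.prems(5) by (simp add: numeral_2_eq_2 add.commute)
      show "codim_le n r (adjoin u L)" by (rule codim_le_adjoin[OF Suc.prems(3) Lsub u(1,2)])
      show "adjoin u L \<subseteq> carrier_vec n"
        using vec_subspace_adjoin[OF Lsub u(1)] by (auto simp: vec_subspace_iff)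
      show "l \<bullet> (M *\<^sub>v x) = 0" if "M \<in> S" "l \<in> adjoin u L" for M l
        using adjoin_subset[OF U LU, of u] u that by auto
    qed (rule x(1))
    have S': "?S \<subseteq> sym_mats n" using S by auto
    note IH = Suc.IH[OF S' L' kills' D']
    define H' where "H' = (if x \<in> ?U then ?U else ?L)"
    have "H' \<noteq> carrier_vec n"
    proof (cases "x \<in> ?U")
      case True
      show ?thesis
      proof
        assume "H' = carrier_vec n"
        then have all: "w \<bullet> (M *\<^sub>v x) = 0" if "w \<in> carrier_vec n" "M \<in> S" for w M
          using True that unfolding H'_def by auto
        have "M *\<^sub>v x = 0\<^sub>v n" if M: "M \<in> S" for M
        proof (rule eq_vecI)
          fix i assume "i < dim_vec (0\<^sub>v n :: 'a vec)"
          moreover have "M *\<^sub>v x \<in> carrier_vec n" using M S x by (auto simp: sym_mats_def)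
          ultimately show "(M *\<^sub>v x) $ i = 0\<^sub>v n $ i"
            using all[OF unit_vec_carrier M, of i] by simp
        qed (use M S in \<open>auto simp: sym_mats_def\<close>)
        \<comment> \<open>All of \<open>S\<close> would then kill \<open>?L\<close>, of codimension
          at most \<open>r\<close>, which bounds its dimension by \<open>Suc r choose 2\<close>, one
          less than assumed.\<close>
        then have "?S = S" by auto
        then show False
          using not_dim_ge_if_kills[OF S' L' kills'] Suc.prems(5) by simp
      qed
    next
      case False
      show ?thesis
      proof
        assume all: "H' = carrier_vec n"
        obtain M where M: "M \<in> ?S" "M \<noteq> 0\<^sub>m n n" using dim_ge_nonzero[OF D'] by blast
        have "?L = carrier_vec n" using all False unfolding H'_def by (simp only: if_False)
        then have "M = 0\<^sub>m n n"
          using M(1) S kills'[OF M(1)]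
          by (intro kills_all_imp_zero) (auto simp: sym_mats_def)
        then show False using M by simp
      qed
    qed
    moreover have "vec_subspace n H'" using U L' by (simp add: H'_def)
    moreover have "?L \<subseteq> H'" using adjoin_subset[OF U LU] by (auto simp: H'_def)
    ultimately obtain z where z: "z \<in> carrier_vec n" "z \<notin> H'"
      and good: "\<And>w. w \<in> carrier_vec n \<Longrightarrow> (\<And>M. M \<in> ?S \<Longrightarrow> w \<bullet> (M *\<^sub>v z) = 0) \<Longrightarrow> w \<in> ?L"
      using IH[of H'] by blast
    obtain a where a: "\<And>t. z + t \<cdot>\<^sub>v x \<in> H \<Longrightarrow> t = a"
      using vec_subspace_line[OF H x z(1)] by blast
    have "\<exists>b. \<forall>t. z + t \<cdot>\<^sub>v x \<in> ?U \<longrightarrow> t = b"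
    proof (cases "x \<in> ?U")
      case True
      \<comment> \<open>Here the line is parallel to \<open>?U\<close> and \<open>z\<close> avoids
        \<open>?U\<close>, so the line misses it altogether and any \<open>b\<close> will
        do.\<close>
      have "z + t \<cdot>\<^sub>v x \<notin> ?U" for t
      proof
        assume "z + t \<cdot>\<^sub>v x \<in> ?U"
        then have "(z + t \<cdot>\<^sub>v x) + (- t) \<cdot>\<^sub>v x \<in> ?U" using U True unfolding vec_subspace_iff by blast
        moreover have "(z + t \<cdot>\<^sub>v x) + (- t) \<cdot>\<^sub>v x = z" using z x by (intro eq_vecI) auto
        ultimately show False using z(2) True by (simp add: H'_def)
      qed
      then show ?thesis by blast
    next
      case False
      show ?thesis by (rule vec_subspace_line[OF U x(1) False z(1)])
    qed
    then obtain b where b: "\<And>t. z + t \<cdot>\<^sub>v x \<in> ?U \<Longrightarrow> t = b" by blast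
    obtain t where t: "t \<noteq> a" "t \<noteq> b" using exists_third_element[OF K] by blast
    let ?z = "z + t \<cdot>\<^sub>v x"
    have zc: "?z \<in> carrier_vec n" using z x by simp
    have "w \<in> L" if w: "w \<in> carrier_vec n" "\<forall>M\<in>S. w \<bullet> (M *\<^sub>v ?z) = 0" for w
    proof -
      \<comment> \<open>Matrices in \<open>?S\<close> kill \<open>x\<close>, so they do not
        distinguish \<open>?z\<close> from \<open>z\<close>, and the goodness of \<open>z\<close>
        modulo \<open>?L\<close> applies.\<close>
      have "w \<bullet> (M *\<^sub>v z) = 0" if "M \<in> ?S" for M
      proof -
        have "M \<in> carrier_mat n n" using that S by (auto simp: sym_mats_def)
        then have "M *\<^sub>v ?z = M *\<^sub>v z" using that z x
          by (auto simp: mult_add_distrib_mat_vec[of _ n n] mult_mat_vec[of _ n n])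
        then show ?thesis using that w(2) by auto
      qed
      then have "w \<in> ?L" using good[OF w(1)] by blast
      then obtain l c where lc: "w = l + c \<cdot>\<^sub>v x" "l \<in> L" by (auto simp: adjoin_def)
      have lcar: "l \<in> carrier_vec n" using lc L by auto
      \<comment> \<open>Otherwise \<open>x\<close> would be orthogonal to every
        \<open>M *\<^sub>v ?z\<close>; by symmetry \<open>?z\<close> would lie in \<open>?U\<close>,
        which \<open>t \<noteq> b\<close> excludes.\<close>
      have "c = 0"
      proof (rule ccontr)
        assume c: "c \<noteq> 0"
        have "?z \<bullet> (M *\<^sub>v x) = 0" if M: "M \<in> S" for M
        proof -
          have Mz: "M *\<^sub>v ?z \<in> carrier_vec n" using M S zc by (auto simp: sym_mats_def)
          have "0 = w \<bullet> (M *\<^sub>v ?z)" using w(2) M by simp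
          also have "\<dots> = l \<bullet> (M *\<^sub>v ?z) + c * (x \<bullet> (M *\<^sub>v ?z))"
            using Mz lcar x(1) unfolding lc(1) by (simp add: add_scalar_prod_distrib[of _ n])
          also have "l \<bullet> (M *\<^sub>v ?z) = 0" by (rule perp[OF M lc(2) zc])
          finally have "x \<bullet> (M *\<^sub>v ?z) = 0" using c by simp
          then show ?thesis using sym_mats_scalar_prod[of M n x ?z] M S x zc by auto
        qed
        then show False using b[of t] t zc by auto
      qed
      then have "w = l" using lc(1) lcar x(1) by (intro eq_vecI) auto
      then show ?thesis using lc(2) by simp
    qed
    then show False using no_good zc a t by blast
  qed
qed

section \<open>Range-compatible linear maps on spaces of symmetric matrices\<close>

locale range_compatible_map =
  fixes n :: nat and S :: "'a :: field mat set" and F :: "'a mat \<Rightarrow> 'a vec"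
  assumes S_sym: "S \<subseteq> sym_mats n"
    and S_add: "\<And>M N. M \<in> S \<Longrightarrow> N \<in> S \<Longrightarrow> M + N \<in> S"
    and S_smult: "\<And>c M. M \<in> S \<Longrightarrow> c \<cdot>\<^sub>m M \<in> S"
    and F_closed: "\<And>M. M \<in> S \<Longrightarrow> F M \<in> carrier_vec n"
    and F_add: "\<And>M N. M \<in> S \<Longrightarrow> N \<in> S \<Longrightarrow> F (M + N) = F M + F N"
    and F_smult: "\<And>c M. M \<in> S \<Longrightarrow> F (c \<cdot>\<^sub>m M) = c \<cdot>\<^sub>v F M"
    and F_range: "range_compatible n S F"
begin

lemma S_carrier: "M \<in> S \<Longrightarrow> M \<in> carrier_mat n n"
  using S_sym by (auto simp: sym_mats_def)

lemma mult_closed: "M \<in> S \<Longrightarrow> y \<in> carrier_vec n \<Longrightarrow> M *\<^sub>v y \<in> carrier_vec n"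
  by (rule mult_mat_vec_carrier[OF S_carrier])

text \<open>The image of a symmetric matrix is orthogonal to its kernel. Range compatibility enters
  the argument only in this form.\<close>

lemma F_vanishes:
  assumes "M \<in> S" "y \<in> carrier_vec n" "M *\<^sub>v y = 0\<^sub>v n"
  shows "F M \<bullet> y = 0"
proof -
  note M = S_carrier[OF assms(1)]
  obtain x where x: "x \<in> carrier_vec n" "F M = M *\<^sub>v x"
  proof -
    have "F M \<in> vec_space.col_space n M" using F_range assms(1) by (simp add: range_compatible_def)
    then show ?thesis using that M unfolding vec_space.col_space_eq[OF M] by auto
  qed
  have "F M \<bullet> y = y \<bullet> (M *\<^sub>v x)" using x M assms(2) by (simp add: comm_scalar_prod[of _ n])
  also have "\<dots> = x \<bullet> (M *\<^sub>v y)"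
    using assms(1,2) S_sym x(1) by (auto intro: sym_mats_scalar_prod)
  finally show ?thesis using assms(3) x(1) by simp
qed

(* Extends the factorisation through M -> M y from the matrices with M y = 0 to all of S, one
   coordinate of M y at a time. *)
lemma F_factors_upto:
  assumes y: "y \<in> carrier_vec n" and "k \<le> n"
  shows "\<exists>g\<in>carrier_vec n. \<forall>M\<in>S. (\<forall>i. k \<le> i \<longrightarrow> i < n \<longrightarrow> (M *\<^sub>v y) $ i = 0) \<longrightarrow> F M \<bullet> y = g \<bullet> (M *\<^sub>v y)"
  using assms(2)
proof (induction k)
  case 0
  have "F M \<bullet> y = 0\<^sub>v n \<bullet> (M *\<^sub>v y)" if "M \<in> S" "\<forall>i. i < n \<longrightarrow> (M *\<^sub>v y) $ i = 0" for M
  proof -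
    have "M *\<^sub>v y = 0\<^sub>v n" using that S_carrier[OF that(1)] by (intro eq_vecI) auto
    then show ?thesis using F_vanishes[OF that(1) y] by simp
  qed
  then show ?case by (intro bexI[of _ "0\<^sub>v n"]) auto
next
  case (Suc k)
  then have k: "k < n" by simp
  let ?P = "\<lambda>k M. \<forall>i. k \<le> i \<longrightarrow> i < n \<longrightarrow> (M *\<^sub>v y) $ i = 0"
  obtain g where g: "g \<in> carrier_vec n" "\<And>M. M \<in> S \<Longrightarrow> ?P k M \<Longrightarrow> F M \<bullet> y = g \<bullet> (M *\<^sub>v y)"
    using Suc by auto
  have P_k: "?P k M" if "?P (Suc k) M" "(M *\<^sub>v y) $ k = 0" for M
    using that by (metis Suc_leI le_neq_implies_less)
  show ?case
  proof (cases "\<exists>N\<in>S. ?P (Suc k) N \<and> (N *\<^sub>v y) $ k \<noteq> 0")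
    case False
    then have "F M \<bullet> y = g \<bullet> (M *\<^sub>v y)" if "M \<in> S" "?P (Suc k) M" for M
      using that by (intro g(2)[OF that(1)] P_k) auto
    then show ?thesis using g(1) by blast
  next
    case True
    then obtain N where N: "N \<in> S" "?P (Suc k) N" "(N *\<^sub>v y) $ k \<noteq> 0" by blast
    \<comment> \<open>\<open>d\<close> makes the factorisation hold at \<open>N\<close>. Matrices
      whose coordinate \<open>k\<close> of \<open>M *\<^sub>v y\<close> vanishes do not notice the
      correction, and every other \<open>M\<close> becomes one of them after subtracting a multiple
      of \<open>N\<close>.\<close>
    define d where "d = (F N \<bullet> y - g \<bullet> (N *\<^sub>v y)) / (N *\<^sub>v y) $ k"
    let ?g = "g + d \<cdot>\<^sub>v unit_vec n k"
    have "F M \<bullet> y = ?g \<bullet> (M *\<^sub>v y)" if M: "M \<in> S" "?P (Suc k) M" for M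
    proof -
      define c where "c = - ((M *\<^sub>v y) $ k / (N *\<^sub>v y) $ k)"
      note Mc = mult_closed[OF M(1) y] and Nc = mult_closed[OF N(1) y]
      have in_S: "M + c \<cdot>\<^sub>m N \<in> S" using S_add[OF M(1) S_smult[OF N(1)]] .
      have comb: "(M + c \<cdot>\<^sub>m N) *\<^sub>v y = M *\<^sub>v y + c \<cdot>\<^sub>v (N *\<^sub>v y)"
        using S_carrier[OF M(1)] S_carrier[OF N(1)] y
        by (simp add: add_mult_distrib_mat_vec[of _ n n] smult_mat_mult_vec[of _ n n])
      have "?P k (M + c \<cdot>\<^sub>m N)"
      proof (rule P_k)
        show "?P (Suc k) (M + c \<cdot>\<^sub>m N)" unfolding comb
          using M(2) N(2) S_carrier[OF M(1)] S_carrier[OF N(1)] by (auto simp del: index_mult_mat_vec)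
        show "((M + c \<cdot>\<^sub>m N) *\<^sub>v y) $ k = 0"
          unfolding comb using N(3) S_carrier[OF M(1)] S_carrier[OF N(1)] k
          by (simp add: c_def del: index_mult_mat_vec)
      qed
      then have "F (M + c \<cdot>\<^sub>m N) \<bullet> y = g \<bullet> (M *\<^sub>v y + c \<cdot>\<^sub>v (N *\<^sub>v y))"
        using g(2)[OF in_S] comb by simp
      also have "F (M + c \<cdot>\<^sub>m N) \<bullet> y = F M \<bullet> y + c * (F N \<bullet> y)"
        using F_add[OF M(1) S_smult[OF N(1)]] F_smult[OF N(1)] F_closed M(1) N(1) y
        by (simp add: add_scalar_prod_distrib[of _ n])
      also have "g \<bullet> (M *\<^sub>v y + c \<cdot>\<^sub>v (N *\<^sub>v y)) = g \<bullet> (M *\<^sub>v y) + c * (g \<bullet> (N *\<^sub>v y))"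
        using g(1) Mc Nc by (simp add: scalar_prod_add_distrib[of _ n])
      finally have "F M \<bullet> y = g \<bullet> (M *\<^sub>v y) - c * (F N \<bullet> y - g \<bullet> (N *\<^sub>v y))"
        by (simp add: algebra_simps)
      also have "\<dots> = g \<bullet> (M *\<^sub>v y) + d * (M *\<^sub>v y) $ k" by (simp add: c_def d_def)
      also have "\<dots> = ?g \<bullet> (M *\<^sub>v y)"
        using g(1) Mc smult_scalar_prod_distrib[OF unit_vec_carrier Mc] scalar_prod_left_unit[OF Mc k]
        by (simp add: add_scalar_prod_distrib[of _ n])
      finally show ?thesis .
    qed
    then show ?thesis using g(1) by (intro bexI[of _ ?g]) auto
  qed
qed

lemma F_factors:
  assumes "y \<in> carrier_vec n"
  shows "\<exists>g\<in>carrier_vec n. \<forall>M\<in>S. F M \<bullet> y = g \<bullet> (M *\<^sub>v y)"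
  using F_factors_upto[OF assms order.refl] by auto

lemma local_if_dim_ge:
  assumes K: "infinite (UNIV :: 'a set) \<or> card (UNIV :: 'a set) > 2"
    and D: "dim_ge n S (Suc (Suc (n choose 2)))"
  shows "local_map n S F"
proof -
  \<comment> \<open>\<open>m\<close> will be the codimension of the line K y. For n = 0 the only
    matrix is zero, against the dimension bound.\<close>
  obtain m where m: "n = Suc m"
  proof (cases n)
    case 0
    obtain M where "M \<in> S" "M \<noteq> 0\<^sub>m n n" using dim_ge_nonzero[OF D] by blast
    then show ?thesis using 0 S_carrier[of M] by auto
  qed
  have proper: "{0\<^sub>v n :: 'a vec} \<noteq> carrier_vec n"
  proof
    assume "{0\<^sub>v n :: 'a vec} = carrier_vec n"
    then have "unit_vec n 0 = (0\<^sub>v n :: 'a vec)" using unit_vec_carrier by blast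
    then have "unit_vec n 0 $ 0 = (0\<^sub>v n :: 'a vec) $ 0" by simp
    then show False using m by simp
  qed
  have kills_zero: "M *\<^sub>v l = 0\<^sub>v n" if "M \<in> S" "l \<in> {0\<^sub>v n}" for M and l :: "'a vec"
    using that S_carrier[of M] by auto
  obtain y where "y \<in> carrier_vec n - {0\<^sub>v n}"
    and "\<forall>u\<in>carrier_vec n. (\<forall>M\<in>S. u \<bullet> (M *\<^sub>v y) = 0) \<longrightarrow> u \<in> {0\<^sub>v n}"
    using exists_good_vector[OF K S_sym vec_subspace_zero codim_le_zero kills_zero
        dim_ge_mono[OF D] vec_subspace_zero order.refl proper] by auto
  then have y: "y \<in> carrier_vec n" "y \<noteq> 0\<^sub>v n"
    and y_good: "\<And>u. u \<in> carrier_vec n \<Longrightarrow> (\<And>M. M \<in> S \<Longrightarrow> u \<bullet> (M *\<^sub>v y) = 0) \<Longrightarrow> u = 0\<^sub>v n"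
    by auto
  let ?L = "adjoin y {0\<^sub>v n}"
  let ?S = "{M \<in> S. M *\<^sub>v y = 0\<^sub>v n}"
  have L: "vec_subspace n ?L" by (rule vec_subspace_adjoin[OF vec_subspace_zero y(1)])
  have codim_L: "codim_le n m ?L"
    using codim_le_zero[of n] codim_le_adjoin[OF _ vec_subspace_zero y(1)] y(2) m by auto
  have S': "?S \<subseteq> sym_mats n" using S_sym by auto
  have kills: "M *\<^sub>v l = 0\<^sub>v n" if "M \<in> ?S" "l \<in> ?L" for M l
  proof (rule kills_adjoin[of M n "{0\<^sub>v n}" y])
    show "M *\<^sub>v l' = 0\<^sub>v n" if "l' \<in> {0\<^sub>v n}" for l'
      using kills_zero[OF _ that, of M] \<open>M \<in> ?S\<close> by blast
  qed (use that S' y(1) in auto)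
  have D': "dim_ge n ?S (Suc (m choose 2))"
  proof (rule dim_ge_annihilator[OF S_sym _ _ codim_le_zero y(1)])
    show "dim_ge n S (Suc (m choose 2) + n)"
      using D by (simp add: m numeral_2_eq_2 add.commute)
  qed (use mult_closed y in auto)
  \<comment> \<open>\<open>g v\<close> is chosen separately for each \<open>v\<close>; nothing is
    known about its dependence on \<open>v\<close>, not even linearity.\<close>
  obtain g where g: "\<And>v. v \<in> carrier_vec n \<Longrightarrow> g v \<in> carrier_vec n"
    and Fg: "\<And>v M. v \<in> carrier_vec n \<Longrightarrow> M \<in> S \<Longrightarrow> F M \<bullet> v = g v \<bullet> (M *\<^sub>v v)"
    using F_factors by metis
  define X where "X = g y"
  have X: "X \<in> carrier_vec n" using g y by (simp add: X_def)
  define H where "H = {z \<in> carrier_vec n. \<forall>M\<in>S. F M \<bullet> z = X \<bullet> (M *\<^sub>v z)}"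
  have H: "vec_subspace n H"
    unfolding vec_subspace_iff
  proof (intro conjI ballI allI)
    show "H \<subseteq> carrier_vec n" by (auto simp: H_def)
    show "0\<^sub>v n \<in> H" using kills_zero X F_closed by (auto simp: H_def)
    show "v + w \<in> H" if "v \<in> H" "w \<in> H" for v w
      using that X F_closed mult_closed S_carrier
      by (auto simp: H_def scalar_prod_add_distrib[of _ n] mult_add_distrib_mat_vec[of _ n n])
    show "c \<cdot>\<^sub>v v \<in> H" if "v \<in> H" for c v
      using that X F_closed mult_closed S_carrier
      by (auto simp: H_def mult_mat_vec[of _ n n])
  qed
  have "y \<in> H" using y Fg by (auto simp: H_def X_def)
  then have LH: "?L \<subseteq> H" using H by (intro adjoin_subset[OF H]) (auto simp: vec_subspace_iff)
  have "H = carrier_vec n"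
  proof (rule ccontr)
    assume "H \<noteq> carrier_vec n"
    then obtain z where z: "z \<in> carrier_vec n" "z \<notin> H"
      and z_good: "\<And>u. u \<in> carrier_vec n \<Longrightarrow> (\<And>M. M \<in> ?S \<Longrightarrow> u \<bullet> (M *\<^sub>v z) = 0) \<Longrightarrow> u \<in> ?L"
      using exists_good_vector[OF K S' L codim_L kills D' H LH] by blast
    have line: "\<exists>d. X = g z + d \<cdot>\<^sub>v (y + c \<cdot>\<^sub>v z)" if c: "c \<noteq> 0" for c
    proof -
      let ?w = "y + c \<cdot>\<^sub>v z"
      have w: "?w \<in> carrier_vec n" using y z by simp
      \<comment> \<open>Expand \<open>F M \<bullet> ?w\<close> twice, through \<open>g ?w\<close>
        and through linearity in the vector, and subtract.\<close>
      have eq: "(g ?w - X) \<bullet> (M *\<^sub>v y) + c * ((g ?w - g z) \<bullet> (M *\<^sub>v z)) = 0" if M: "M \<in> S" for M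
      proof -
        note My = mult_closed[OF M y(1)] and Mz = mult_closed[OF M z(1)]
        have "M *\<^sub>v ?w = M *\<^sub>v y + c \<cdot>\<^sub>v (M *\<^sub>v z)"
          using S_carrier[OF M] y z
          by (simp add: mult_add_distrib_mat_vec[of _ n n] mult_mat_vec[of _ n n])
        then have "F M \<bullet> ?w = g ?w \<bullet> (M *\<^sub>v y) + c * (g ?w \<bullet> (M *\<^sub>v z))"
          using Fg[OF w M] g[OF w] My Mz by (simp add: scalar_prod_add_distrib[of _ n])
        moreover have "F M \<bullet> ?w = X \<bullet> (M *\<^sub>v y) + c * (g z \<bullet> (M *\<^sub>v z))"
          using Fg[OF y(1) M] Fg[OF z(1) M] F_closed[OF M] y z
          by (simp add: scalar_prod_add_distrib[of _ n] X_def)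
        ultimately show ?thesis
          using g[OF w] g[OF z(1)] X My Mz
          by (simp add: minus_scalar_prod_distrib[of _ n] algebra_simps)
      qed
      \<comment> \<open>For \<open>M\<close> in \<open>?S\<close> the first term of
        \<open>eq\<close> vanishes; \<open>c\<close> cancels, and \<open>z\<close> is good modulo
        \<open>y\<close>.\<close>
      have "g ?w - g z \<in> ?L"
      proof (rule z_good)
        show "(g ?w - g z) \<bullet> (M *\<^sub>v z) = 0" if "M \<in> ?S" for M
          using eq[of M] that c g[OF w] X by auto
      qed (use g[OF w] g[OF z(1)] in simp)
      then obtain d where d: "g ?w - g z = d \<cdot>\<^sub>v y" using y(1) by (auto simp: adjoin_def)
      \<comment> \<open>By symmetry \<open>y \<bullet> (M *\<^sub>v z)\<close> is
        \<open>z \<bullet> (M *\<^sub>v y)\<close>, so \<open>eq\<close> becomes a single product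
        with \<open>M *\<^sub>v y\<close> and the goodness of \<open>y\<close> applies. Eliminating
        \<open>g ?w\<close> from the two relations then gives the claim.\<close>
      have "(g ?w - X) + (c * d) \<cdot>\<^sub>v z = 0\<^sub>v n"
      proof (rule y_good)
        show "((g ?w - X) + (c * d) \<cdot>\<^sub>v z) \<bullet> (M *\<^sub>v y) = 0" if M: "M \<in> S" for M
        proof -
          have "(d \<cdot>\<^sub>v y) \<bullet> (M *\<^sub>v z) = d * (z \<bullet> (M *\<^sub>v y))"
            using sym_mats_scalar_prod[of M n y z] M S_sym y(1) z(1) mult_closed[OF M z(1)] by auto
          then have "(g ?w - X) \<bullet> (M *\<^sub>v y) + c * (d * (z \<bullet> (M *\<^sub>v y))) = 0"
            using eq[OF M] d by simp
          then show ?thesis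
            using mult_closed[OF M y(1)] g[OF w] X z(1)
            by (simp add: add_scalar_prod_distrib[of _ n] mult.assoc)
        qed
      qed (use g[OF w] X z in simp)
      then have zero: "((g ?w - X) + (c * d) \<cdot>\<^sub>v z) $ i = 0" if "i < n" for i using that by simp
      have "X = g z + d \<cdot>\<^sub>v (y + c \<cdot>\<^sub>v z)"
      proof (rule eq_vecI)
        fix i assume "i < dim_vec (g z + d \<cdot>\<^sub>v (y + c \<cdot>\<^sub>v z))"
        then have i: "i < n" using y z by simp
        have "(g ?w - g z) $ i = (d \<cdot>\<^sub>v y) $ i" using d by simp
        then show "X $ i = (g z + d \<cdot>\<^sub>v (y + c \<cdot>\<^sub>v z)) $ i"
          using zero[OF i] i g[OF w] g[OF z(1)] X y(1) z(1) by (simp add: algebra_simps)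
      qed (use X y z g[OF z(1)] in simp)
      then show ?thesis by blast
    qed
    obtain c :: 'a where c: "c \<noteq> 0" "c \<noteq> 1" using exists_third_element[OF K] by blast
    obtain d where d: "X = g z + d \<cdot>\<^sub>v (y + 1 \<cdot>\<^sub>v z)" using line[of 1] by auto
    obtain e where e: "X = g z + e \<cdot>\<^sub>v (y + c \<cdot>\<^sub>v z)" using line[OF c(1)] by auto
    \<comment> \<open>\<open>y\<close> and \<open>z\<close> are independent, since \<open>z\<close>
      lies outside \<open>H\<close> while \<open>y \<noteq> 0\<close> lies in it. Both coefficients
      must therefore vanish, and d = e = e c with c \<noteq> 1 forces d = 0.\<close>
    have dep: "(d - e) * y $ i + (d - e * c) * z $ i = 0" if i: "i < n" for i
    proof -
      have "(g z + d \<cdot>\<^sub>v (y + 1 \<cdot>\<^sub>v z)) $ i = (g z + e \<cdot>\<^sub>v (y + c \<cdot>\<^sub>v z)) $ i" using d e by simp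
      then show ?thesis using i g[OF z(1)] y(1) z(1) by (simp add: algebra_simps)
    qed
    have de: "d = e * c"
    proof (rule ccontr)
      assume ne: "d \<noteq> e * c"
      have "z = (- (d - e) / (d - e * c)) \<cdot>\<^sub>v y"
      proof (rule eq_vecI)
        fix i assume "i < dim_vec ((- (d - e) / (d - e * c)) \<cdot>\<^sub>v y)"
        then have i: "i < n" using y by simp
        have "(d - e * c) * z $ i = - (d - e) * y $ i"
          using dep[OF i] by (simp only: add_eq_0_iff minus_mult_left)
        then have "z $ i = (- (d - e) * y $ i) / (d - e * c)"
          using ne by (metis nonzero_mult_div_cancel_left right_minus_eq)
        then show "z $ i = ((- (d - e) / (d - e * c)) \<cdot>\<^sub>v y) $ i" using i y by simp
      qed (use y z in simp)
      then have "z \<in> H" using H \<open>y \<in> H\<close> unfolding vec_subspace_iff by metis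
      then show False using z by simp
    qed
    have "d = e"
    proof (rule ccontr)
      assume "d \<noteq> e"
      then have "y = 0\<^sub>v n" using dep de y by (intro eq_vecI) auto
      then show False using y by simp
    qed
    then have "d = 0" using de c by simp
    then have "X = g z" using d y z g[OF z(1)] by (intro eq_vecI) auto
    then show False using z Fg by (simp add: H_def)
  qed
  then have FX: "F M \<bullet> v = X \<bullet> (M *\<^sub>v v)" if "M \<in> S" "v \<in> carrier_vec n" for M v
    using that by (auto simp: H_def)
  have "F M = M *\<^sub>v X" if M: "M \<in> S" for M
  proof (rule eq_vecI)
    fix i assume "i < dim_vec (M *\<^sub>v X)"
    then have i: "i < n" using S_carrier[OF M] by simp
    have "F M $ i = F M \<bullet> unit_vec n i" using i F_closed[OF M] by simp
    also have "\<dots> = unit_vec n i \<bullet> (M *\<^sub>v X)"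
      using FX[OF M] sym_mats_scalar_prod[of M n X "unit_vec n i"] M S_sym X by auto
    also have "\<dots> = (M *\<^sub>v X) $ i" using i mult_closed[OF M X] by simp
    finally show "F M $ i = (M *\<^sub>v X) $ i" .
  qed (use F_closed[OF M] S_carrier[OF M] in simp)
  then show ?thesis unfolding local_map_def using X by blast
qed

end

section \<open>Dimensions of spaces of symmetric matrices\<close>

text \<open>Independent sets in \<open>W\<close> stay independent in \<open>V\<close>, so their size
  is bounded by \<open>dim\<close>; a maximal one is a basis of \<open>W\<close>.\<close>

lemma (in vectorspace) subspace_fin_dim:
  assumes fin: fin_dim and W: "subspace K W V"
  shows "vectorspace.fin_dim K (vs W)"
proof -
  interpret W: vectorspace K "vs W" by (rule subspace_is_vs[OF W])
  have sub: "submodule K W V" using W by (rule is_module)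
  have WV: "W \<subseteq> carrier V" using sub by (simp add: submodule_def)
  let ?P = "\<lambda>A. A \<subseteq> carrier (vs W) \<and> W.lin_indpt A"
  have "finite A \<and> card A \<le> dim" if "?P A" for A
  proof -
    have "A \<subseteq> W" using that by simp
    then have "lin_indpt A" using that span_li_not_depend(2)[OF _ sub, of A] by simp
    then show ?thesis using li_le_dim[OF fin, of A] \<open>A \<subseteq> W\<close> WV by auto
  qed
  moreover have "?P {}" by (simp add: W.lin_dep_def)
  ultimately obtain A where A: "finite A" "maximal A ?P"
    using maximal_exists[of ?P dim "{}"] by blast
  have "W.basis A" by (rule W.max_li_is_basis[OF A(2)])
  then show ?thesis using A(1) unfolding W.basis_def W.fin_dim_def by blast
qed

lemma sym_space_simps:
  "carrier (sym_space TYPE('a :: field) n) = sym_mats n"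
  "add (sym_space TYPE('a) n) = (+)"
  "zero (sym_space TYPE('a) n) = 0\<^sub>m n n"
  "smult (sym_space TYPE('a) n) = (\<cdot>\<^sub>m)"
  by (simp_all add: sym_space_def module_mat_simps)

text \<open>Evaluating the forms in \<open>ps\<close> maps \<open>S\<close> linearly into a space of
  dimension \<open>length ps < k\<close>. Without a nonzero common zero this map would be injective,
  which rank-nullity forbids.\<close>

lemma dim_ge_if_dim:
  fixes S :: "'a :: field mat set"
  assumes S: "subspace class_ring S (sym_space TYPE('a) n)"
    and fin: "vectorspace.fin_dim class_ring (sym_space TYPE('a) n)"
    and k: "k \<le> vectorspace.dim class_ring ((sym_space TYPE('a) n)\<lparr>carrier := S\<rparr>)"
  shows "dim_ge n S k"
  unfolding dim_ge_def
proof (intro allI impI)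
  fix ps :: "('a vec \<times> 'a vec) list"
  assume ps: "set ps \<subseteq> carrier_vec n \<times> carrier_vec n" "length ps < k"
  let ?V = "(sym_space TYPE('a) n)\<lparr>carrier := S\<rparr>"
  let ?W = "module_vec TYPE('a) (length ps)"
  let ?f = "\<lambda>M i. fst (ps ! i) \<bullet> (M *\<^sub>v snd (ps ! i))"
  let ?T = "\<lambda>M. vec (length ps) (?f M)"
  have SS: "S \<subseteq> sym_mats n"
    using S by (auto simp: subspace_def submodule_def sym_space_simps)
  have S_add: "M + N \<in> S" if "M \<in> S" "N \<in> S" for M N
    using S that by (simp add: subspace_def submodule_def sym_space_simps)
  have S_smult: "c \<cdot>\<^sub>m M \<in> S" if "M \<in> S" for c M
    using S that by (simp add: subspace_def submodule_def sym_space_simps)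
  have M: "M \<in> carrier_mat n n" if "M \<in> S" for M using SS that by (auto simp: sym_mats_def)
  have nth: "fst (ps ! i) \<in> carrier_vec n" "snd (ps ! i) \<in> carrier_vec n" if "i < length ps" for i
    using subsetD[OF ps(1) nth_mem[OF that]] by (auto simp: mem_Times_iff)
  have add: "?f (M + N) i = ?f M i + ?f N i" if "M \<in> S" "N \<in> S" "i < length ps" for M N i
    using M[OF that(1)] M[OF that(2)] nth[OF that(3)]
    by (simp add: add_mult_distrib_mat_vec[of _ n n] scalar_prod_add_distrib[of _ n])
  have smult: "?f (c \<cdot>\<^sub>m N) i = c * ?f N i" if "N \<in> S" "i < length ps" for N i c
    using M[OF that(1)] nth[OF that(2)]
    by (simp add: smult_mat_mult_vec[of _ n n])
  have T_add: "?T (M + N) = ?T M + ?T N" if "M \<in> S" "N \<in> S" for M N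
    by (rule eq_vecI) (simp_all add: add[OF that])
  have T_smult: "?T (c \<cdot>\<^sub>m N) = c \<cdot>\<^sub>v ?T N" if "N \<in> S" for c N
    by (rule eq_vecI) (simp_all add: smult[OF that])
  have hom: "?T \<in> LinearCombinations.module_hom class_ring ?V ?W"
    using T_add T_smult by (simp add: LinearCombinations.module_hom_def sym_space_simps module_vec_simps)
  show "\<exists>M\<in>S. M \<noteq> 0\<^sub>m n n \<and> (\<forall>(v, w)\<in>set ps. v \<bullet> (M *\<^sub>v w) = 0)"
  proof (rule ccontr)
    assume no: "\<not> ?thesis"
    have zero: "M = 0\<^sub>m n n" if "M \<in> S" and TM: "?T M = 0\<^sub>v (length ps)" for M
    proof -
      have "v \<bullet> (M *\<^sub>v w) = 0" if vw: "(v, w) \<in> set ps" for v w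
      proof -
        obtain i where i: "i < length ps" "ps ! i = (v, w)"
          using vw unfolding in_set_conv_nth by blast
        have "?f M i = ?T M $ i" by (rule index_vec[OF i(1), symmetric])
        also have "\<dots> = 0" unfolding TM by (rule index_zero_vec(1)[OF i(1)])
        finally show ?thesis unfolding i(2) by simp
      qed
      then show ?thesis using no that by blast
    qed
    have "inj_on ?T S"
    proof (rule inj_onI)
      fix M N assume MN: "M \<in> S" "N \<in> S" "?T M = ?T N"
      have neg: "(-1) \<cdot>\<^sub>m N \<in> S" using S_smult[OF MN(2)] .
      have "?T (M + (-1) \<cdot>\<^sub>m N) = ?T N + (-1) \<cdot>\<^sub>v ?T N"
        unfolding T_add[OF MN(1) neg] T_smult[OF MN(2)] MN(3) ..
      also have "\<dots> = 0\<^sub>v (length ps)" by (rule eq_vecI) simp_all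
      finally have diff: "M + (-1) \<cdot>\<^sub>m N = 0\<^sub>m n n" using zero[OF S_add[OF MN(1) neg]] by simp
      show "M = N"
      proof (rule eq_matI)
        fix i j assume "i < dim_row N" "j < dim_col N"
        then have ij: "i < n" "j < n" using M[OF MN(2)] by auto
        have "(M + (-1) \<cdot>\<^sub>m N) $$ (i, j) = 0" unfolding diff using ij by simp
        then show "M $$ (i, j) = N $$ (i, j)" using ij M[OF MN(1)] M[OF MN(2)] by simp
      qed (use M[OF MN(1)] M[OF MN(2)] in auto)
    qed
    then have inj: "inj_on ?T (carrier ?V)" by simp
    interpret sym: vectorspace class_ring "sym_space TYPE('a) n" by (rule vectorspace_sym_space)
    interpret V: vectorspace class_ring ?V by (rule sym.subspace_is_vs[OF S])
    interpret W: vec_space "TYPE('a)" "length ps" .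
    interpret T: linear_map class_ring ?V ?W ?T
      by unfold_locales (rule hom)
    have "V.fin_dim" by (rule sym.subspace_fin_dim[OF fin S])
    note rank = T.rank_nullity[OF this, unfolded T.inj_imp_dim_ker0[OF inj] add_0_right]
    have "V.dim \<le> W.dim"
      unfolding rank[symmetric]
      by (rule W.subspace_dim[OF T.imT_is_subspace W.fin_dim
            W.subspace_fin_dim[OF W.fin_dim T.imT_is_subspace]])
    then show False using k ps(2) unfolding W.dim_is_n by linarith
  qed
qed

lemma card_upper_triangle: "card (SIGMA j:{..<n}. {..j}) = Suc n choose 2"
proof -
  have "(\<Sum>j<n. Suc j) = Suc n choose 2"
    by (induction n) (simp_all add: numeral_2_eq_2)
  then show ?thesis by simp
qed

text \<open>The entries on one side of the diagonal, including it, are free coordinates of a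
  symmetric matrix; \<open>h\<close> numbers their positions.\<close>

lemma sym_space_dim:
  "vectorspace.fin_dim class_ring (sym_space TYPE('a :: field) n)"
  "vectorspace.dim class_ring (sym_space TYPE('a) n) = Suc n choose 2"
proof -
  let ?P = "SIGMA j:{..<n}. {..j}"
  let ?N = "Suc n choose 2"
  obtain h where h: "bij_betw h ?P {..<?N}"
    using ex_bij_betw_finite_nat[of ?P] card_upper_triangle[of n]
    by (auto simp: atLeast0LessThan)
  \<comment> \<open>Sorting the indices, the larger one first as in \<open>?P\<close>, makes
    \<open>?T v\<close> symmetric by construction.\<close>
  let ?T = "\<lambda>v :: 'a vec. mat n n (\<lambda>(i, j). v $ h (max i j, min i j))"
  have h_less: "h (max i j, min i j) < ?N" if "i < n" "j < n" for i j
    using bij_betwE[OF h] that by auto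
  have T_sym: "?T v \<in> sym_mats n" for v
    unfolding sym_mats_def by (auto intro!: eq_matI simp: max.commute min.commute)
  have T_add: "?T (v + w) = ?T v + ?T w" if "v \<in> carrier_vec ?N" "w \<in> carrier_vec ?N" for v w
    using that h_less by (intro eq_matI) auto
  have T_smult: "?T (c \<cdot>\<^sub>v v) = c \<cdot>\<^sub>m ?T v" if "v \<in> carrier_vec ?N" for c v
    using that h_less by (intro eq_matI) auto
  have hom: "?T \<in> LinearCombinations.module_hom class_ring (module_vec TYPE('a) ?N) (sym_space TYPE('a) n)"
    using T_add T_smult T_sym by (simp add: LinearCombinations.module_hom_def sym_space_simps module_vec_simps)
  interpret V: vec_space "TYPE('a)" ?N .
  interpret W: vectorspace class_ring "sym_space TYPE('a) n" by (rule vectorspace_sym_space)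
  interpret T: linear_map class_ring "module_vec TYPE('a) ?N" "sym_space TYPE('a) n" ?T
    by unfold_locales (rule hom)
  have inj: "inj_on ?T (carrier_vec ?N)"
  proof (rule inj_onI, rule eq_vecI)
    fix v w :: "'a vec" and k
    assume vw: "v \<in> carrier_vec ?N" "w \<in> carrier_vec ?N" "?T v = ?T w" "k < dim_vec w"
    then have "k \<in> h ` ?P" using h by (auto simp: bij_betw_def)
    then obtain j i where ij: "j < n" "i \<le> j" "k = h (j, i)" by auto
    then have "?T v $$ (i, j) = v $ k" "?T w $$ (i, j) = w $ k" by (auto simp: max_def min_def)
    then show "v $ k = w $ k" using vw(3) by simp
  qed auto
  have surj: "?T ` carrier_vec ?N = sym_mats n"
  proof
    show "sym_mats n \<subseteq> ?T ` carrier_vec ?N"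
    proof
      fix M :: "'a mat" assume M: "M \<in> sym_mats n"
      then have car: "M \<in> carrier_mat n n" and tr: "M\<^sup>T = M" by (auto simp: sym_mats_def)
      let ?v = "vec ?N (\<lambda>k. M $$ inv_into ?P h k)"
      have "?T ?v = M"
      proof (rule eq_matI)
        fix i j assume "i < dim_row M" "j < dim_col M"
        then have ij: "i < n" "j < n" using car by auto
        have "inv_into ?P h (h (max i j, min i j)) = (max i j, min i j)"
          using h ij by (intro inv_into_f_f) (auto simp: bij_betw_def)
        then have "?T ?v $$ (i, j) = M $$ (max i j, min i j)" using ij h_less by simp
        also have "\<dots> = M $$ (i, j)"
        proof -
          have "M $$ (j, i) = M $$ (i, j)" using ij car tr by (metis carrier_matD index_transpose_mat(1))
          then show ?thesis by (simp add: max_def min_def)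
        qed
        finally show "?T ?v $$ (i, j) = M $$ (i, j)" .
      qed (use car in auto)
      then show "M \<in> ?T ` carrier_vec ?N" by (rule image_eqI[OF sym vec_carrier])
    qed
  qed (use T_sym in auto)
  show "vectorspace.fin_dim class_ring (sym_space TYPE('a) n)"
    using T.image_fin_dim[OF V.fin_dim] surj by (simp add: sym_space_simps module_vec_simps)
  have "V.dim = W.dim"
    using inj surj by (intro T.dim_eq[OF V.fin_dim]) (auto simp: sym_space_simps module_vec_simps)
  then show "W.dim = Suc n choose 2" using V.dim_is_n by simp
qed

theorem corollary1p6:
  fixes n :: nat
    and S :: "'a :: field mat set"
    and F :: "'a mat \<Rightarrow> 'a vec"
  assumes "infinite (UNIV :: 'a set) \<or> card (UNIV :: 'a set) > 2"
    and "subspace class_ring S (sym_space TYPE('a) n)"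
    and "codim class_ring S (sym_space TYPE('a) n) \<le> int n - 2"
    and "linear_map class_ring ((sym_space TYPE('a) n)\<lparr>carrier := S\<rparr>) (module_vec TYPE('a) n) F"
    and "range_compatible n S F"
  shows "local_map n S F"
proof -
  have hom: "F \<in> LinearCombinations.module_hom class_ring ((sym_space TYPE('a) n)\<lparr>carrier := S\<rparr>) (module_vec TYPE('a) n)"
    using assms(4) by (simp add: linear_map_def mod_hom_def mod_hom_axioms_def)
  interpret range_compatible_map n S F
  proof
    show "S \<subseteq> sym_mats n" "\<And>M N. M \<in> S \<Longrightarrow> N \<in> S \<Longrightarrow> M + N \<in> S" "\<And>c M. M \<in> S \<Longrightarrow> c \<cdot>\<^sub>m M \<in> S"
      using assms(2) by (auto simp: subspace_def submodule_def sym_space_simps)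
    show "\<And>M. M \<in> S \<Longrightarrow> F M \<in> carrier_vec n"
      "\<And>M N. M \<in> S \<Longrightarrow> N \<in> S \<Longrightarrow> F (M + N) = F M + F N"
      "\<And>c M. M \<in> S \<Longrightarrow> F (c \<cdot>\<^sub>m M) = c \<cdot>\<^sub>v F M"
      using hom by (auto simp: LinearCombinations.module_hom_def sym_space_simps module_vec_simps)
  qed (rule assms(5))
  \<comment> \<open>\<open>Suc n choose 2\<close> is \<open>(n choose 2) + n\<close>, so the
    codimension bound leaves this dimension, also for n < 2, where n - 2 is negative.\<close>
  have "Suc (Suc (n choose 2)) \<le> vectorspace.dim class_ring ((sym_space TYPE('a) n)\<lparr>carrier := S\<rparr>)"
    using assms(3) unfolding codim_def sym_space_dim by (simp add: numeral_2_eq_2)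
  then show ?thesis
    by (intro local_if_dim_ge[OF assms(1)] dim_ge_if_dim[OF assms(2) sym_space_dim(1)])
qed

end
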